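(* Let $\lambda_0,\dots,\lambda_n\in\mathbb{C}$, $\Lambda_n=(\lambda_0,\dots,\lambda_n)$, and let $a\neq b$ be real numbers. The space $E_{(\lambda_0,\dots,\lambda_n)}$ is an extended Chebyshev system with respect to $\{a,b\}$ if and only if there exists a (unique) Bernstein-like basis $p_{n,k}$, $k=0,\dots,n$, for $a,b$ satisfying the condition $$k!\lim_{x\to a,\,x>a}\frac{p_{n,k}(x)}{(x-a)^k}=p_{n,k}^{(k)}(a)=1\qquad (k=0,\dots,n).$$ In this case the basis functions are given recursively as follows: writing $q_k:=p_{n,n-k}$, one has $$q_0(x)=\Phi_{\Lambda_n}(x-a),\qquad q_1=q_0^{(1)}-\alpha_0 q_0,$$ $$q_k=q_{k-1}^{(1)}-(\alpha_{k-1}-\alpha_{k-2})\,q_{k-1}-\beta_k\,q_{k-2}\qquad (2\le k\le n),$$ where $$\alpha_0=\frac{q_0^{(1)}(b)}{q_0(b)},\qquad \alpha_{k-1}=\frac{q_{k-1}^{(k)}(b)}{q_{k-1}^{(k-1)}(b)},\qquad \beta_k=\frac{q_{k-1}^{(k-1)}(b)}{q_{k-2}^{(k-2)}(b)}\qquad(2\le k\le n).$$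
   Context: For $\lambda_0,\dots,\lambda_n\in\mathbb{C}$, $E_{(\lambda_0,\dots,\lambda_n)}$ is the $(n+1)$-dimensional complex vector space of all $f\in C^\infty(\mathbb{R},\mathbb{C})$ with $\left(\frac{d}{dx}-\lambda_0\right)\cdots\left(\frac{d}{dx}-\lambda_n\right)f=0$. The fundamental function $\Phi_{\Lambda_n}$ is the unique element of $E_{(\lambda_0,\dots,\lambda_n)}$ with $\Phi_{\Lambda_n}(0)=\dots=\Phi_{\Lambda_n}^{(n-1)}(0)=0$ and $\Phi_{\Lambda_n}^{(n)}(0)=1$. A function $f$ has a zero of (exact) order $k$ at $a$ if $f(a)=\dots=f^{(k-1)}(a)=0$ and $f^{(k)}(a)\ne 0$. $E_{(\lambda_0,\dots,\lambda_n)}$ is an extended Chebyshev system with respect to a set $A$ if every $f\in E_{(\lambda_0,\dots,\lambda_n)}$ that has more than $n$ zeros in $A$, counted with multiplicities, is identically $0$. A Bernstein-like basis for $E_{(\lambda_0,\dots,\lambda_n)}$ and $a\ne b$ is a system of functions $p_{n,k}\in E_{(\lambda_0,\dots,\lambda_n)}$, $k=0,\dots,n$, such that each $p_{n,k}$ has a zero of exact order $k$ at $a$ and a zero of exact order $n-k$ at $b$. *)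

theory Defs
  imports "HOL-Analysis.Analysis" "HOL-Library.Extended_Nat"
begin

definition nderiv :: "nat \<Rightarrow> (real \<Rightarrow> complex) \<Rightarrow> real \<Rightarrow> complex" where
  "nderiv k f = ((\<lambda>g x. vector_derivative g (at x)) ^^ k) f"

definition smooth_fun :: "(real \<Rightarrow> complex) \<Rightarrow> bool" where
  "smooth_fun f \<longleftrightarrow> (\<forall>k x. nderiv k f differentiable (at x))"

definition first_order_op :: "complex \<Rightarrow> (real \<Rightarrow> complex) \<Rightarrow> real \<Rightarrow> complex" where
  "first_order_op l f = (\<lambda>x. vector_derivative f (at x) - l * f x)"

text \<open>The exponents \<open>\<lambda>\<^sub>0, \<dots>, \<lambda>\<^sub>n\<close> are given as a list of length \<open>n + 1\<close>; the
  right fold applies the factor belonging to \<open>\<lambda>\<^sub>n\<close> first.\<close>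

definition exp_space :: "complex list \<Rightarrow> (real \<Rightarrow> complex) set" where
  "exp_space Lam = {f. smooth_fun f \<and> (\<forall>x. foldr first_order_op Lam f x = 0)}"

text \<open>The fundamental function; for nonempty \<open>Lam\<close> the initial value problem has exactly one
  solution.\<close>

definition fundamental_fun :: "complex list \<Rightarrow> real \<Rightarrow> complex" where
  "fundamental_fun Lam = (THE f. f \<in> exp_space Lam \<and>
     (\<forall>j < length Lam - 1. nderiv j f 0 = 0) \<and> nderiv (length Lam - 1) f 0 = 1)"

definition has_zero_of_order :: "(real \<Rightarrow> complex) \<Rightarrow> nat \<Rightarrow> real \<Rightarrow> bool" where
  "has_zero_of_order f k a \<longleftrightarrow> (\<forall>j<k. nderiv j f a = 0) \<and> nderiv k f a \<noteq> 0"

text \<open>The multiplicity is \<open>k\<close> at a zero of exact order \<open>k\<close> (in particular \<open>0\<close> where \<open>f\<close> does not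
  vanish), and \<open>\<infinity>\<close> where all derivatives of \<open>f\<close> vanish.\<close>

definition zero_mult :: "(real \<Rightarrow> complex) \<Rightarrow> real \<Rightarrow> enat" where
  "zero_mult f a = (SUP k \<in> {k. \<forall>j<k. nderiv j f a = 0}. enat k)"

definition zero_count :: "(real \<Rightarrow> complex) \<Rightarrow> real set \<Rightarrow> enat" where
  "zero_count f A = (SUP S \<in> {S. finite S \<and> S \<subseteq> A}. \<Sum>s\<in>S. zero_mult f s)"

definition extended_chebyshev :: "complex list \<Rightarrow> real set \<Rightarrow> bool" where
  "extended_chebyshev Lam A \<longleftrightarrow>
     (\<forall>f \<in> exp_space Lam. enat (length Lam - 1) < zero_count f A \<longrightarrow> (\<forall>x. f x = 0))"

text \<open>Only the members \<open>p 0, \<dots>, p n\<close> with \<open>n = length Lam - 1\<close> matter. Linear independence is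
  not part of the definition; it follows from the distinct orders of the zeros at \<open>a\<close>.\<close>

definition bernstein_like_basis ::
    "complex list \<Rightarrow> real \<Rightarrow> real \<Rightarrow> (nat \<Rightarrow> real \<Rightarrow> complex) \<Rightarrow> bool" where
  "bernstein_like_basis Lam a b p \<longleftrightarrow>
     (\<forall>k \<le> length Lam - 1. p k \<in> exp_space Lam \<and>
        has_zero_of_order (p k) k a \<and> has_zero_of_order (p k) (length Lam - 1 - k) b)"

definition normalized_at :: "nat \<Rightarrow> real \<Rightarrow> (nat \<Rightarrow> real \<Rightarrow> complex) \<Rightarrow> bool" where
  "normalized_at n a p \<longleftrightarrow>
     (\<forall>k \<le> n. \<exists>L. ((\<lambda>x. p k x / complex_of_real (x - a) ^ k) \<longlongrightarrow> L) (at_right a) \<and>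
        fact k * L = nderiv k (p k) a \<and> nderiv k (p k) a = 1)"

end

theory Submission
  imports Defs "HOL-Complex_Analysis.Cauchy_Integral_Formula"
begin

text \<open>A normalized basis is built from the fundamental function at \<open>a\<close>: differentiating lowers the order
  of the zero at \<open>a\<close> by one and keeps the leading coefficient, and subtracting multiples of the two
  previous functions raises the order of the zero at \<open>b\<close>. The divisions are legitimate because a zero
  at \<open>b\<close> of too high an order would contradict the Chebyshev property, which also gives uniqueness
  and hence the recursion for every normalized basis. Conversely, a Bernstein-like basis spans the
  space, since a function vanishing to order \<open>n + 1\<close> at \<open>a\<close> is \<open>0\<close>; comparing orders at \<open>a\<close>
  and \<open>b\<close> in the expansion of a function with \<open>n + 1\<close> zeros kills all coefficients.\<close>

section \<open>Iterated derivatives and smooth functions\<close>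

lemma nderiv_0 [simp]: "nderiv 0 f = f"
  by (simp add: nderiv_def)

lemma nderiv_Suc: "nderiv (Suc k) f = (\<lambda>x. vector_derivative (nderiv k f) (at x))"
  by (simp add: nderiv_def)

lemma nderiv_nderiv: "nderiv k (nderiv m f) = nderiv (k + m) f"
  by (simp add: nderiv_def funpow_add)

lemma smooth_fun_has_vector_derivative:
  "smooth_fun f \<Longrightarrow> (nderiv k f has_vector_derivative nderiv (Suc k) f x) (at x)"
  by (simp add: nderiv_Suc smooth_fun_def vector_derivative_works[symmetric])

text \<open>A candidate sequence of derivatives settles smoothness and all iterated derivatives at
  once; the closure lemmas below only exhibit such a sequence.\<close>

lemma smooth_funI:
  assumes "g 0 = f" and "\<And>k x. (g k has_vector_derivative g (Suc k) x) (at x)"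
  shows "nderiv k f = g k" and "smooth_fun f"
proof -
  have *: "nderiv k f = g k" for k
  proof (induction k)
    case (Suc k)
    then show ?case
      using vector_derivative_at[OF assms(2)] by (auto simp: nderiv_Suc)
  qed (use assms(1) in simp)
  then show "nderiv k f = g k" .
  show "smooth_fun f"
    unfolding smooth_fun_def * using assms(2) differentiableI_vector by blast
qed

lemma smooth_fun_nderiv: "smooth_fun f \<Longrightarrow> smooth_fun (nderiv m f)"
  by (simp add: smooth_fun_def nderiv_nderiv)

lemma
  assumes "smooth_fun f" and "smooth_fun g"
  shows nderiv_lincomb:
      "nderiv k (\<lambda>x. c * f x + d * g x) = (\<lambda>x. c * nderiv k f x + d * nderiv k g x)"
    and smooth_fun_lincomb: "smooth_fun (\<lambda>x. c * f x + d * g x)"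
proof -
  have *: "((\<lambda>x. c * nderiv k f x + d * nderiv k g x) has_vector_derivative
      c * nderiv (Suc k) f x + d * nderiv (Suc k) g x) (at x)" for k x
    by (intro has_vector_derivative_add has_vector_derivative_mult_right
        smooth_fun_has_vector_derivative assms)
  note rules = smooth_funI[where g = "\<lambda>k x. c * nderiv k f x + d * nderiv k g x", OF _ *]
  show "nderiv k (\<lambda>x. c * f x + d * g x) = (\<lambda>x. c * nderiv k f x + d * nderiv k g x)"
    by (rule rules) simp
  show "smooth_fun (\<lambda>x. c * f x + d * g x)"
    by (rule rules) simp
qed

lemma
  assumes "smooth_fun f"
  shows nderiv_shift: "nderiv k (\<lambda>x. f (x + c)) = (\<lambda>x. nderiv k f (x + c))"
    and smooth_fun_shift: "smooth_fun (\<lambda>x. f (x + c))"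
proof -
  have *: "((\<lambda>x. nderiv k f (x + c)) has_vector_derivative nderiv (Suc k) f (x + c)) (at x)" for k x
  proof -
    have "((\<lambda>x. x + c) has_vector_derivative 1) (at x)"
      by (auto intro!: derivative_eq_intros simp: has_real_derivative_iff_has_vector_derivative[symmetric])
    from vector_diff_chain_at[OF this smooth_fun_has_vector_derivative[OF assms]]
    show ?thesis by (simp add: o_def)
  qed
  note rules = smooth_funI[where g = "\<lambda>k x. nderiv k f (x + c)", OF _ *]
  show "nderiv k (\<lambda>x. f (x + c)) = (\<lambda>x. nderiv k f (x + c))"
    by (rule rules) simp
  show "smooth_fun (\<lambda>x. f (x + c))"
    by (rule rules) simp
qed

lemma smooth_fun_of_real_holomorphic:
  assumes "F holomorphic_on UNIV"
  shows "smooth_fun (\<lambda>x. F (of_real x))"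
proof (rule smooth_funI(2)[where g = "\<lambda>k x. (deriv ^^ k) F (of_real x)"])
  fix k and x :: real
  have "(deriv ^^ k) F holomorphic_on UNIV"
    using assms by (intro holomorphic_higher_deriv) auto
  then have "((deriv ^^ k) F has_field_derivative (deriv ^^ Suc k) F (of_real x)) (at (of_real x))"
    by (simp add: holomorphic_derivI)
  then show "((\<lambda>x. (deriv ^^ k) F (of_real x)) has_vector_derivative
      (deriv ^^ Suc k) F (of_real x)) (at x)"
    by (rule has_vector_derivative_real_field)
qed simp

text \<open>Leading Taylor coefficient as a limit, by induction through the derivative. For complex
  values the mean value inequality takes the place of l'Hospital's rule.\<close>

lemma smooth_fun_tendsto_div_power:
  assumes "smooth_fun f" and "\<And>j. j < k \<Longrightarrow> nderiv j f a = 0"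
  shows "((\<lambda>x. f x / of_real (x - a) ^ k) \<longlongrightarrow> nderiv k f a / fact k) (at_right a)"
  using assms
proof (induction k arbitrary: f)
  case 0
  have "isCont f a"
    using smooth_fun_has_vector_derivative[OF 0(1), of 0 a]
    by (simp add: has_vector_derivative_continuous)
  then have "(f \<longlongrightarrow> f a) (at_right a)"
    using isCont_def filterlim_at_split by blast
  then show ?case
    by simp
next
  case (Suc k)
  define L where "L = nderiv (Suc k) f a / fact (Suc k)"
  \<comment> \<open>Subtracting the expected leading term reduces the claim to \<open>h\<close>
    being small against \<open>(x - a) ^ Suc k\<close>.\<close>
  define h where "h x = f x - L * of_real (x - a) ^ Suc k" for x
  define h' where "h' x = nderiv 1 f x - L * of_nat (Suc k) * of_real (x - a) ^ k" for x
  have der: "(h has_vector_derivative h' x) (at x)" for x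
  proof -
    have "((\<lambda>z. L * (z - of_real a) ^ Suc k) has_field_derivative
        L * (of_nat (Suc k) * (of_real x - of_real a) ^ k)) (at (of_real x))"
      by (rule DERIV_cmult derivative_eq_intros refl | simp)+
    from has_vector_derivative_diff[OF smooth_fun_has_vector_derivative[OF Suc.prems(1), of 0 x]
        has_vector_derivative_real_field[OF this]]
    show ?thesis
      unfolding h_def h'_def by (simp add: mult.assoc del: of_nat_Suc power_Suc)
  qed
  have "((\<lambda>x. nderiv 1 f x / of_real (x - a) ^ k) \<longlongrightarrow> nderiv k (nderiv 1 f) a / fact k) (at_right a)"
    by (rule Suc.IH) (use Suc.prems in \<open>auto simp: nderiv_nderiv smooth_fun_nderiv\<close>)
  moreover have "nderiv k (nderiv 1 f) a / fact k = L * of_nat (Suc k)"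
    by (simp add: L_def nderiv_nderiv divide_simps del: of_nat_Suc)
  ultimately have lim: "((\<lambda>x. nderiv 1 f x / of_real (x - a) ^ k) \<longlongrightarrow> L * of_nat (Suc k)) (at_right a)"
    by simp
  have "\<forall>\<^sub>F x in at_right a. dist (f x / of_real (x - a) ^ Suc k) L < e" if "e > 0" for e
  proof -
    from tendstoD[OF lim, of "e / 2"] that obtain b where b: "b > a"
      and near: "\<And>y. a < y \<Longrightarrow> y < b \<Longrightarrow>
        dist (nderiv 1 f y / of_real (y - a) ^ k) (L * of_nat (Suc k)) < e / 2"
      by (auto simp: eventually_at_right_field)
    have "dist (f x / of_real (x - a) ^ Suc k) L < e" if x: "a < x" "x < b" for x
    proof -
      have bound: "norm (h' y) \<le> e / 2 * (x - a) ^ k" if y: "a < y" "y < x" for y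
      proof -
        have "h' y = (nderiv 1 f y / of_real (y - a) ^ k - L * of_nat (Suc k)) * of_real (y - a) ^ k"
          using y by (simp add: h'_def field_simps)
        then have "norm (h' y) = dist (nderiv 1 f y / of_real (y - a) ^ k) (L * of_nat (Suc k)) * (y - a) ^ k"
          using y by (simp add: norm_mult norm_power dist_norm del: of_nat_Suc of_real_diff)
        also have "\<dots> \<le> e / 2 * (x - a) ^ k"
          using near[of y] y x \<open>e > 0\<close> by (intro mult_mono power_mono) auto
        finally show ?thesis .
      qed
      \<comment> \<open>Mean value inequality between \<open>a\<close> and \<open>x\<close>: it
        supplies the missing factor \<open>x - a\<close>.\<close>
      have "norm (h x - h a) \<le> (e / 2 * (x - a) ^ k) * (x - a)"
      proof -
        have "continuous_on {a..x} h"
          using der by (meson continuous_at_imp_continuous_on has_vector_derivative_continuous)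
        then obtain y where y: "a < y" "y < x" "norm (h x - h a) \<le> norm ((x - a) *\<^sub>R h' y)"
          using mvt_general[OF x(1), of h "\<lambda>y t. t *\<^sub>R h' y"] der
          by (auto simp: has_vector_derivative_def)
        then have "norm (h x - h a) \<le> norm (h' y) * (x - a)" using x by (simp add: mult_ac)
        also have "\<dots> \<le> (e / 2 * (x - a) ^ k) * (x - a)"
          using bound[OF y(1,2)] x by (intro mult_right_mono) auto
        finally show ?thesis .
      qed
      then have "norm (h x) \<le> e / 2 * (x - a) ^ Suc k"
        using Suc.prems(2)[of 0] by (simp add: h_def mult_ac)
      moreover have "f x / of_real (x - a) ^ Suc k - L = h x / of_real (x - a) ^ Suc k"
        using x by (simp add: h_def field_simps)
      ultimately have "dist (f x / of_real (x - a) ^ Suc k) L \<le> e / 2"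
        using x by (simp add: dist_norm norm_divide norm_power norm_mult divide_simps
            del: power_Suc of_real_diff)
      then show ?thesis using \<open>e > 0\<close> by simp
    qed
    then show ?thesis
      using b by (auto simp: eventually_at_right_field)
  qed
  then show ?case
    unfolding L_def[symmetric] by (rule tendstoI)
qed

section \<open>Spaces of exponential polynomials\<close>

lemma first_order_op_eq: "first_order_op l f = (\<lambda>x. 1 * nderiv 1 f x + (- l) * f x)"
  by (simp add: first_order_op_def nderiv_Suc)

lemma
  assumes "smooth_fun f"
  shows nderiv_first_order_op:
      "nderiv k (first_order_op l f) = (\<lambda>x. nderiv (Suc k) f x - l * nderiv k f x)"
    and smooth_fun_first_order_op: "smooth_fun (first_order_op l f)"
  unfolding first_order_op_eq
  using nderiv_lincomb[OF smooth_fun_nderiv[OF assms, of 1] assms, where c = 1 and d = "- l"]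
    smooth_fun_lincomb[OF smooth_fun_nderiv[OF assms, of 1] assms, where c = 1 and d = "- l"]
  by (simp_all add: nderiv_nderiv)

lemma nderiv_zero [simp]: "nderiv k (\<lambda>x. 0) = (\<lambda>x. 0)"
  by (induction k) (simp_all add: nderiv_Suc)

lemma exp_space_Nil: "exp_space [] = {\<lambda>x. 0}"
  by (auto simp: exp_space_def smooth_fun_def)

lemma exp_space_smooth_fun: "f \<in> exp_space Lam \<Longrightarrow> smooth_fun f"
  by (simp add: exp_space_def)

text \<open>\<open>foldr\<close> applies the last factor first, so dropping the last exponent peels
  off the innermost operator; this drives the inductions by \<open>rev_induct\<close>.\<close>

lemma exp_space_snoc:
  "f \<in> exp_space (Lam @ [l]) \<longleftrightarrow> smooth_fun f \<and> first_order_op l f \<in> exp_space Lam"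
  by (auto simp: exp_space_def smooth_fun_first_order_op)

lemma exp_space_lincomb:
  "f \<in> exp_space Lam \<Longrightarrow> g \<in> exp_space Lam \<Longrightarrow> (\<lambda>x. c * f x + d * g x) \<in> exp_space Lam"
proof (induction Lam arbitrary: f g rule: rev_induct)
  case Nil
  then show ?case by (simp add: exp_space_Nil)
next
  case (snoc l Lam)
  then have s: "smooth_fun f" "smooth_fun g" by (auto simp: exp_space_snoc)
  have "first_order_op l (\<lambda>x. c * f x + d * g x) =
      (\<lambda>x. c * first_order_op l f x + d * first_order_op l g x)"
    unfolding first_order_op_eq nderiv_lincomb[OF s] by (auto simp: algebra_simps)
  with snoc s show ?case
    by (simp add: exp_space_snoc smooth_fun_lincomb)
qed

lemma exp_space_diff:
  "f \<in> exp_space Lam \<Longrightarrow> g \<in> exp_space Lam \<Longrightarrow> (\<lambda>x. f x - c * g x) \<in> exp_space Lam"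
  using exp_space_lincomb[of f Lam g 1 "- c"] by simp

lemma nderiv_diff:
  "smooth_fun f \<Longrightarrow> smooth_fun g \<Longrightarrow>
    nderiv k (\<lambda>x. f x - c * g x) = (\<lambda>x. nderiv k f x - c * nderiv k g x)"
  using nderiv_lincomb[of f g k 1 "- c"] by simp

text \<open>Constant-coefficient operators commute with differentiation and, in the next lemma, with
  translation.\<close>

lemma exp_space_nderiv_1: "f \<in> exp_space Lam \<Longrightarrow> nderiv 1 f \<in> exp_space Lam"
proof (induction Lam arbitrary: f rule: rev_induct)
  case Nil
  then show ?case by (simp add: exp_space_Nil)
next
  case (snoc l Lam)
  then have s: "smooth_fun f" by (simp add: exp_space_snoc)
  have "first_order_op l (nderiv 1 f) = nderiv 1 (first_order_op l f)"
    unfolding nderiv_first_order_op[OF s] unfolding first_order_op_eq nderiv_nderiv by simp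
  with snoc s show ?case
    by (simp add: exp_space_snoc smooth_fun_nderiv)
qed

lemma exp_space_shift: "f \<in> exp_space Lam \<Longrightarrow> (\<lambda>x. f (x + c)) \<in> exp_space Lam"
proof (induction Lam arbitrary: f rule: rev_induct)
  case Nil
  then show ?case by (simp add: exp_space_Nil)
next
  case (snoc l Lam)
  then have s: "smooth_fun f" by (simp add: exp_space_snoc)
  have "first_order_op l (\<lambda>x. f (x + c)) = (\<lambda>x. first_order_op l f (x + c))"
    by (simp add: first_order_op_eq nderiv_shift[OF s])
  with snoc s show ?case
    by (simp add: exp_space_snoc smooth_fun_shift)
qed

section \<open>Initial value problems and the fundamental function\<close>

text \<open>Applying the innermost operator costs one order of vanishing at \<open>a\<close>, so by
  induction \<open>first_order_op l f\<close> is zero and a first-order equation remains.\<close>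

lemma exp_space_eq_zero:
  assumes "f \<in> exp_space Lam" and "\<And>j. j < length Lam \<Longrightarrow> nderiv j f a = 0"
  shows "f = (\<lambda>x. 0)"
  using assms
proof (induction Lam arbitrary: f rule: rev_induct)
  case Nil
  then show ?case by (simp add: exp_space_Nil)
next
  case (snoc l Lam)
  then have s: "smooth_fun f" by (simp add: exp_space_snoc)
  have "first_order_op l f = (\<lambda>x. 0)"
    using snoc.prems by (intro snoc.IH) (auto simp: exp_space_snoc nderiv_first_order_op[OF s])
  then have D: "nderiv 1 f x = l * f x" for x
    by (auto simp: first_order_op_eq fun_eq_iff)
  \<comment> \<open>Integrating factor: the product is constant, and its value at \<open>a\<close>
    is zero.\<close>
  have "((\<lambda>x. exp (- l * of_real x) * f x) has_vector_derivative 0) (at x)" for x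
  proof -
    have "((\<lambda>z. exp (- l * z)) has_field_derivative - l * exp (- l * of_real x)) (at (of_real x))"
      by (auto intro!: derivative_eq_intros)
    from has_vector_derivative_mult[OF has_vector_derivative_real_field[OF this]
        smooth_fun_has_vector_derivative[OF s, of 0 x]]
    show ?thesis using D[of x] by (simp add: algebra_simps)
  qed
  then obtain c where c: "\<And>x. exp (- l * of_real x) * f x = c"
    using has_vector_derivative_zero_constant[of UNIV "\<lambda>x. exp (- l * of_real x) * f x"] by auto
  have "f a = 0" using snoc.prems(2)[of 0] by simp
  with c[of a] have "c = 0" by simp
  with c show ?case by auto
qed

lemma exp_space_eqI:
  assumes "f \<in> exp_space Lam" and "g \<in> exp_space Lam"
    and "\<And>j. j < length Lam \<Longrightarrow> nderiv j f a = nderiv j g a"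
  shows "f = g"
proof -
  have "(\<lambda>x. f x - 1 * g x) = (\<lambda>x. 0)"
    using assms
    by (intro exp_space_eq_zero[where a = a] exp_space_diff)
      (auto simp: nderiv_diff[of f g _ 1, simplified] exp_space_smooth_fun)
  then show ?thesis by (simp add: fun_eq_iff)
qed

text \<open>Adding an exponent \<open>l\<close> to \<open>Lam\<close> amounts to solving \<open>g' = l g + f\<close>, \<open>g(0) = 0\<close>, where \<open>f\<close> is
  the fundamental function of \<open>Lam\<close>. Carrying entire functions along makes smoothness automatic.\<close>

lemma fundamental_fun_exists:
  assumes "Lam \<noteq> []"
  shows "\<exists>F. F holomorphic_on UNIV \<and> (\<lambda>x. F (of_real x)) \<in> exp_space Lam \<and>
    (\<forall>j < length Lam - 1. nderiv j (\<lambda>x. F (of_real x)) 0 = 0) \<and>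
    nderiv (length Lam - 1) (\<lambda>x. F (of_real x)) 0 = 1"
  using assms
proof (induction Lam rule: rev_induct)
  case (snoc l Lam)
  show ?case
  proof (cases "Lam = []")
    \<comment> \<open>The induction effectively starts here: the space for the empty list is zero,
      so a single exponent needs its own solution.\<close>
    case True
    let ?F = "\<lambda>z. exp (l * z)"
    have hol: "?F holomorphic_on UNIV" by (intro holomorphic_intros)
    have "((\<lambda>x. ?F (of_real x)) has_vector_derivative l * ?F (of_real x)) (at x)" for x
      by (rule has_vector_derivative_real_field) (auto intro!: derivative_eq_intros)
    from vector_derivative_at[OF this]
    have "first_order_op l (\<lambda>x. ?F (of_real x)) = (\<lambda>x. 0)"
      by (simp add: first_order_op_def)
    then show ?thesis
      using True smooth_fun_of_real_holomorphic[OF hol] hol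
      by (intro exI[of _ ?F]) (simp add: exp_space_def)
  next
    case False
    then obtain H where H: "H holomorphic_on UNIV" "(\<lambda>x. H (of_real x)) \<in> exp_space Lam"
      "\<And>j. j < length Lam - 1 \<Longrightarrow> nderiv j (\<lambda>x. H (of_real x)) 0 = 0"
      "nderiv (length Lam - 1) (\<lambda>x. H (of_real x)) 0 = 1"
      using snoc.IH by auto
    have "(\<lambda>z. exp (- l * z) * H z) holomorphic_on UNIV"
      by (intro holomorphic_intros H)
    then obtain P where P: "\<And>z. (P has_field_derivative exp (- l * z) * H z) (at z)"
      using holomorphic_convex_primitive'[of UNIV "\<lambda>z. exp (- l * z) * H z"] by auto
    \<comment> \<open>Variation of constants; subtracting \<open>P 0\<close> gives
      \<open>G 0 = 0\<close>.\<close>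
    define G where "G z = exp (l * z) * (P z - P 0)" for z
    have G: "(G has_field_derivative l * G z + H z) (at z)" for z
      unfolding G_def
      by (rule derivative_eq_intros P refl | simp add: exp_minus field_simps)+
    then have hol: "G holomorphic_on UNIV"
      by (auto simp: holomorphic_on_open)
    let ?g = "\<lambda>x. G (of_real x)" and ?h = "\<lambda>x. H (of_real x)"
    have s: "smooth_fun ?g" by (rule smooth_fun_of_real_holomorphic[OF hol])
    have gh: "first_order_op l ?g = ?h"
      using vector_derivative_at[OF has_vector_derivative_real_field[OF G]]
      by (simp add: first_order_op_def)
    \<comment> \<open>Differentiating the equation \<open>k\<close> times passes the initial values
      of \<open>?h\<close> on to \<open>?g\<close>, one order higher.\<close>
    have rec: "nderiv (Suc k) ?g 0 = l * nderiv k ?g 0 + nderiv k ?h 0" for k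
      using fun_cong[OF nderiv_first_order_op[OF s, of k l], of 0] by (simp add: gh)
    have zero: "nderiv j ?g 0 = 0" if "j < length Lam" for j
      using that
    proof (induction j)
      case 0
      then show ?case by (simp add: G_def)
    next
      case (Suc j)
      then show ?case using H(3)[of j] by (simp add: rec)
    qed
    obtain m where m: "length Lam = Suc m" using False by (cases Lam) auto
    have "nderiv (length Lam) ?g 0 = 1"
      using zero[of m] H(4) by (simp add: m rec)
    then show ?thesis
      using hol s zero gh H(2) by (intro exI[of _ G]) (simp add: exp_space_snoc)
  qed
qed simp

lemma fundamental_fun:
  assumes "Lam \<noteq> []"
  shows "fundamental_fun Lam \<in> exp_space Lam"
    and "\<And>j. j < length Lam - 1 \<Longrightarrow> nderiv j (fundamental_fun Lam) 0 = 0"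
    and "nderiv (length Lam - 1) (fundamental_fun Lam) 0 = 1"
proof -
  let ?P = "\<lambda>f. f \<in> exp_space Lam \<and>
     (\<forall>j < length Lam - 1. nderiv j f 0 = 0) \<and> nderiv (length Lam - 1) f 0 = 1"
  have "\<exists>!f. ?P f"
  proof (rule ex_ex1I)
    show "\<exists>f. ?P f" using fundamental_fun_exists[OF assms] by blast
    obtain m where "length Lam = Suc m" using assms by (cases Lam) auto
    then show "f = g" if "?P f" "?P g" for f g
      using that by (intro exp_space_eqI[of f Lam g 0]) (auto simp: less_Suc_eq)
  qed
  from theI'[OF this] have "?P (fundamental_fun Lam)" unfolding fundamental_fun_def .
  then show "fundamental_fun Lam \<in> exp_space Lam"
    and "\<And>j. j < length Lam - 1 \<Longrightarrow> nderiv j (fundamental_fun Lam) 0 = 0"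
    and "nderiv (length Lam - 1) (fundamental_fun Lam) 0 = 1" by auto
qed

section \<open>Counting zeros at two points\<close>

text \<open>The set under the supremum is closed downwards, so the supremum reaches \<open>m\<close>
  exactly when \<open>m\<close> belongs to the set.\<close>

lemma enat_le_zero_mult_iff: "enat m \<le> zero_mult f a \<longleftrightarrow> (\<forall>j<m. nderiv j f a = 0)"
proof
  assume le: "enat m \<le> zero_mult f a"
  show "\<forall>j<m. nderiv j f a = 0"
  proof (rule ccontr)
    assume "\<not> ?thesis"
    then obtain j where j: "j < m" "nderiv j f a \<noteq> 0" by auto
    then have "zero_mult f a \<le> enat j"
      unfolding zero_mult_def by (intro SUP_least) (auto simp: not_less[symmetric])
    with le j show False by (meson enat_ord_simps(1) le_trans not_le order_trans)
  qed
qed (auto simp: zero_mult_def intro!: SUP_upper)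

lemma zero_count_pair:
  assumes "a \<noteq> b"
  shows "zero_count f {a, b} = zero_mult f a + zero_mult f b"
proof (rule antisym)
  have eq: "(\<Sum>s\<in>{a, b}. zero_mult f s) = zero_mult f a + zero_mult f b"
    using assms by simp
  show "zero_count f {a, b} \<le> zero_mult f a + zero_mult f b"
    unfolding zero_count_def eq[symmetric] by (intro SUP_least sum_mono2) auto
  show "zero_mult f a + zero_mult f b \<le> zero_count f {a, b}"
    unfolding zero_count_def eq[symmetric] by (intro SUP_upper) auto
qed

text \<open>Finite lower bounds \<open>i\<close> and \<open>m\<close> on the two multiplicities
  replace arithmetic in \<open>enat\<close>; at a zero of infinite multiplicity the bound
  \<open>Suc n\<close> suffices.\<close>

lemma extended_chebyshev_pair_iff:
  assumes "a \<noteq> b"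
  shows "extended_chebyshev Lam {a, b} \<longleftrightarrow>
    (\<forall>f\<in>exp_space Lam. \<forall>i m. length Lam - 1 < i + m \<longrightarrow> (\<forall>j<i. nderiv j f a = 0) \<longrightarrow>
      (\<forall>j<m. nderiv j f b = 0) \<longrightarrow> (\<forall>x. f x = 0))"
proof -
  have "enat n < zero_mult f a + zero_mult f b \<longleftrightarrow>
    (\<exists>i m. n < i + m \<and> enat i \<le> zero_mult f a \<and> enat m \<le> zero_mult f b)" for n f
  proof
    assume "enat n < zero_mult f a + zero_mult f b"
    then show "\<exists>i m. n < i + m \<and> enat i \<le> zero_mult f a \<and> enat m \<le> zero_mult f b"
    proof (cases "zero_mult f a"; cases "zero_mult f b")
      fix i m assume "zero_mult f a = enat i" "zero_mult f b = enat m"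
      with \<open>enat n < _\<close> show ?thesis by (intro exI[of _ i] exI[of _ m]) simp
    next
      assume "zero_mult f a = \<infinity>"
      then show ?thesis by (intro exI[of _ "Suc n"] exI[of _ 0]) (simp flip: zero_enat_def)
    next
      assume "zero_mult f b = \<infinity>"
      then show ?thesis by (intro exI[of _ 0] exI[of _ "Suc n"]) (simp flip: zero_enat_def)
    next
      assume "zero_mult f b = \<infinity>"
      then show ?thesis by (intro exI[of _ 0] exI[of _ "Suc n"]) (simp flip: zero_enat_def)
    qed
  next
    assume "\<exists>i m. n < i + m \<and> enat i \<le> zero_mult f a \<and> enat m \<le> zero_mult f b"
    then obtain i m where im: "n < i + m" "enat i \<le> zero_mult f a" "enat m \<le> zero_mult f b"
      by auto
    have "enat n < enat i + enat m" using im(1) by simp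
    also have "\<dots> \<le> zero_mult f a + zero_mult f b" using im by (intro add_mono)
    finally show "enat n < zero_mult f a + zero_mult f b" .
  qed
  then show ?thesis
    unfolding extended_chebyshev_def zero_count_pair[OF assms] enat_le_zero_mult_iff by blast
qed

section \<open>Normalized Bernstein-like functions\<close>

text \<open>The index is that of \<open>q\<^sub>k = p\<^sub>n\<^sub>,\<^sub>n\<^sub>-\<^sub>k\<close>. The zero at \<open>b\<close> is only required to have order at least
  \<open>k\<close>; exactness is a consequence of the Chebyshev property.\<close>

definition bernstein_fun ::
    "complex list \<Rightarrow> real \<Rightarrow> real \<Rightarrow> nat \<Rightarrow> (real \<Rightarrow> complex) \<Rightarrow> bool" where
  "bernstein_fun Lam a b k f \<longleftrightarrow> f \<in> exp_space Lam \<and>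
     (\<forall>j < length Lam - 1 - k. nderiv j f a = 0) \<and> nderiv (length Lam - 1 - k) f a = 1 \<and>
     (\<forall>j<k. nderiv j f b = 0)"

context
  fixes Lam :: "complex list" and n :: nat and a b :: real
  assumes len: "length Lam = n + 1" and ab: "a \<noteq> b"
begin

lemma bernstein_fun_iff:
  "bernstein_fun Lam a b k f \<longleftrightarrow> f \<in> exp_space Lam \<and> (\<forall>j < n - k. nderiv j f a = 0) \<and>
     nderiv (n - k) f a = 1 \<and> (\<forall>j<k. nderiv j f b = 0)"
  by (simp add: bernstein_fun_def len)

lemma extended_chebyshev_eq_zero:
  assumes "extended_chebyshev Lam {a, b}" and "f \<in> exp_space Lam" and "n < i + m"
    and "\<And>j. j < i \<Longrightarrow> nderiv j f a = 0" and "\<And>j. j < m \<Longrightarrow> nderiv j f b = 0"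
  shows "f = (\<lambda>x. 0)"
  using assms len unfolding extended_chebyshev_pair_iff[OF ab] by fastforce

text \<open>The equal normalizations cancel in the difference, which thus gains one order at
  \<open>a\<close> and has \<open>n + 1\<close> zeros in all.\<close>

lemma bernstein_fun_unique:
  assumes "extended_chebyshev Lam {a, b}" and "k \<le> n"
    and f: "bernstein_fun Lam a b k f" and g: "bernstein_fun Lam a b k g"
  shows "f = g"
proof -
  have s: "smooth_fun f" "smooth_fun g"
    using f g by (auto simp: bernstein_fun_def exp_space_smooth_fun)
  have "(\<lambda>x. f x - 1 * g x) = (\<lambda>x. 0)"
  proof (rule extended_chebyshev_eq_zero[OF assms(1), where i = "Suc (n - k)" and m = k])
    show "(\<lambda>x. f x - 1 * g x) \<in> exp_space Lam"
      using f g by (intro exp_space_diff) (auto simp: bernstein_fun_def)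
  qed (use f g \<open>k \<le> n\<close> in \<open>auto simp: bernstein_fun_iff nderiv_diff[OF s, of _ 1, simplified] less_Suc_eq\<close>)
  then show ?thesis by (simp add: fun_eq_iff)
qed

text \<open>One more order at \<open>b\<close> would make \<open>n + 1\<close> zeros, forcing
  \<open>f\<close> to be zero against its normalization at \<open>a\<close>.\<close>

lemma bernstein_fun_nonzero:
  assumes "extended_chebyshev Lam {a, b}" and "k \<le> n" and f: "bernstein_fun Lam a b k f"
  shows "nderiv k f b \<noteq> 0"
proof
  assume "nderiv k f b = 0"
  then have "f = (\<lambda>x. 0)"
    using f \<open>k \<le> n\<close>
    by (intro extended_chebyshev_eq_zero[OF assms(1), where i = "n - k" and m = "Suc k"])
      (auto simp: bernstein_fun_iff less_Suc_eq)
  then show False using f by (simp add: bernstein_fun_iff)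
qed

section \<open>The recursion for normalized functions\<close>

lemma bernstein_fun_0: "bernstein_fun Lam a b 0 (\<lambda>x. fundamental_fun Lam (x - a))"
proof -
  have "Lam \<noteq> []" using len by auto
  note F = fundamental_fun[OF this]
  show ?thesis
    using F exp_space_shift[OF F(1), of "- a"]
      nderiv_shift[OF exp_space_smooth_fun[OF F(1)], of _ "- a"]
    by (simp add: bernstein_fun_iff len)
qed

lemma bernstein_fun_0_unique:
  assumes "bernstein_fun Lam a b 0 f" and "bernstein_fun Lam a b 0 g"
  shows "f = g"
  using assms by (intro exp_space_eqI[of f Lam g a]) (auto simp: bernstein_fun_iff len less_Suc_eq)

text \<open>The quotient is chosen to remove the value at \<open>b\<close>; at \<open>a\<close> the
  derivative of \<open>u\<close> alone carries the leading coefficient.\<close>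

lemma bernstein_fun_1:
  assumes C: "extended_chebyshev Lam {a, b}" and "1 \<le> n" and u: "bernstein_fun Lam a b 0 u"
  shows "bernstein_fun Lam a b 1 (\<lambda>x. nderiv 1 u x - nderiv 1 u b / nderiv 0 u b * u x)"
proof -
  have nz: "u b \<noteq> 0" using bernstein_fun_nonzero[OF C _ u] by simp
  have s: "smooth_fun u" and E: "u \<in> exp_space Lam"
    using u by (auto simp: bernstein_fun_def exp_space_smooth_fun)
  define r where "r = nderiv 1 u b / nderiv 0 u b"
  obtain d where d: "n = Suc d" using \<open>1 \<le> n\<close> by (cases n) auto
  have w: "nderiv j (\<lambda>x. nderiv 1 u x - r * u x) = (\<lambda>x. nderiv (Suc j) u x - r * nderiv j u x)" for j
    unfolding nderiv_diff[OF smooth_fun_nderiv[OF s] s] nderiv_nderiv by simp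
  have "nderiv (Suc 0) u b - r * u b = 0" using nz by (simp add: r_def)
  then show ?thesis
    unfolding bernstein_fun_iff r_def[symmetric] w
    using u exp_space_diff[OF exp_space_nderiv_1[OF E] E] by (auto simp: bernstein_fun_iff d)
qed

text \<open>Of the derivatives at \<open>b\<close> up to order \<open>k\<close>, the one of order \<open>k\<close> vanishes by the choice of \<open>\<beta>\<close> and
  the one of order \<open>k + 1\<close> by the choice of the \<open>\<alpha>\<close>'s; lower orders vanish for each summand.\<close>

lemma bernstein_fun_Suc_Suc:
  assumes C: "extended_chebyshev Lam {a, b}" and "Suc (Suc k) \<le> n"
    and v: "bernstein_fun Lam a b k v" and u: "bernstein_fun Lam a b (Suc k) u"
  shows "bernstein_fun Lam a b (Suc (Suc k)) (\<lambda>x. nderiv 1 u x -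
    (nderiv (Suc (Suc k)) u b / nderiv (Suc k) u b - nderiv (Suc k) v b / nderiv k v b) * u x -
    nderiv (Suc k) u b / nderiv k v b * v x)"
    (is "bernstein_fun _ _ _ _ ?w")
proof -
  have nz: "nderiv (Suc k) u b \<noteq> 0" "nderiv k v b \<noteq> 0"
    using bernstein_fun_nonzero[OF C _ u] bernstein_fun_nonzero[OF C _ v] assms(2) by auto
  have E: "u \<in> exp_space Lam" "v \<in> exp_space Lam"
    using u v by (auto simp: bernstein_fun_def)
  then have s: "smooth_fun u" "smooth_fun v" by (auto simp: exp_space_smooth_fun)
  \<comment> \<open>\<open>d\<close> is the order at \<open>a\<close> of the new function;
    \<open>u\<close> and \<open>v\<close> have orders \<open>d + 1\<close> and \<open>d + 2\<close>
    there, so only the derivative of \<open>u\<close> contributes at order \<open>d\<close>.\<close>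
  obtain d where d: "n = Suc (Suc (k + d))" using assms(2) by (metis add_Suc le_Suc_ex)
  define r where "r = nderiv (Suc (Suc k)) u b / nderiv (Suc k) u b - nderiv (Suc k) v b / nderiv k v b"
  define t where "t = nderiv (Suc k) u b / nderiv k v b"
  have E1: "(\<lambda>x. nderiv 1 u x - r * u x) \<in> exp_space Lam"
    by (intro exp_space_diff exp_space_nderiv_1 E)
  have w: "nderiv j (\<lambda>x. nderiv 1 u x - r * u x - t * v x) =
      (\<lambda>x. nderiv (Suc j) u x - r * nderiv j u x - t * nderiv j v x)" for j
    unfolding nderiv_diff[OF exp_space_smooth_fun[OF E1] s(2)]
      nderiv_diff[OF smooth_fun_nderiv[OF s(1)] s(1)] nderiv_nderiv by simp
  have U: "\<And>j. j < Suc d \<Longrightarrow> nderiv j u a = 0" "nderiv (Suc d) u a = 1"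
    "\<And>j. j < Suc k \<Longrightarrow> nderiv j u b = 0"
    using u by (auto simp: bernstein_fun_iff d)
  have V: "\<And>j. j < Suc (Suc d) \<Longrightarrow> nderiv j v a = 0" "\<And>j. j < k \<Longrightarrow> nderiv j v b = 0"
    using v by (auto simp: bernstein_fun_iff d Suc_diff_le)
  have "nderiv (Suc j) u b - r * nderiv j u b - t * nderiv j v b = 0" if "j < Suc (Suc k)" for j
  proof -
    consider "j < k" | "j = k" | "j = Suc k" using \<open>j < _\<close> by linarith
    then show ?thesis
      by cases (use U V nz in \<open>auto simp: r_def t_def field_simps\<close>)
  qed
  then show ?thesis
    unfolding bernstein_fun_iff r_def[symmetric] t_def[symmetric] w
    using U V exp_space_diff[OF E1 E(2)] by (auto simp: d)
qed

text \<open>The recursion serves as construction; its general step uses two predecessors, hence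
  strong induction.\<close>

lemma bernstein_fun_exists:
  assumes C: "extended_chebyshev Lam {a, b}" and "k \<le> n"
  shows "\<exists>f. bernstein_fun Lam a b k f"
  using \<open>k \<le> n\<close>
proof (induction k rule: less_induct)
  case (less k)
  consider "k = 0" | "k = 1" | m where "k = Suc (Suc m)"
    by (metis One_nat_def not0_implies_Suc)
  then show ?case
  proof cases
    case 1
    then show ?thesis using bernstein_fun_0 by blast
  next
    case 2
    then show ?thesis using bernstein_fun_1[OF C] bernstein_fun_0 less.prems by blast
  next
    case (3 m)
    then obtain v u where "bernstein_fun Lam a b m v" "bernstein_fun Lam a b (Suc m) u"
      using less.IH[of m] less.IH[of "Suc m"] less.prems by auto
    then show ?thesis using bernstein_fun_Suc_Suc[OF C] 3 less.prems by blast
  qed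
qed

text \<open>Exact order at \<open>b\<close> comes from \<open>bernstein_fun_nonzero\<close>, exact
  order at \<open>a\<close> from the value \<open>1\<close>, and the limit from
  \<open>smooth_fun_tendsto_div_power\<close>.\<close>

lemma normalized_basis_iff:
  assumes C: "extended_chebyshev Lam {a, b}"
  shows "bernstein_like_basis Lam a b p \<and> normalized_at n a p \<longleftrightarrow>
    (\<forall>k\<le>n. bernstein_fun Lam a b (n - k) (p k))" (is "?L \<longleftrightarrow> ?R")
proof
  assume ?L
  then show ?R
    by (auto simp: bernstein_like_basis_def normalized_at_def bernstein_fun_iff has_zero_of_order_def len)
next
  assume R: ?R
  have "has_zero_of_order (p k) (n - k) b" if "k \<le> n" for k
    using R bernstein_fun_nonzero[OF C, of "n - k" "p k"] that
    by (auto simp: has_zero_of_order_def bernstein_fun_iff)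
  moreover have "\<exists>L. ((\<lambda>x. p k x / complex_of_real (x - a) ^ k) \<longlongrightarrow> L) (at_right a) \<and>
      fact k * L = nderiv k (p k) a" if "k \<le> n" for k
    using R that
    by (intro exI[of _ "nderiv k (p k) a / fact k"] conjI smooth_fun_tendsto_div_power)
      (auto simp: bernstein_fun_iff exp_space_smooth_fun)
  ultimately show ?L
    using R by (auto simp: bernstein_like_basis_def normalized_at_def bernstein_fun_iff
        has_zero_of_order_def len)
qed

text \<open>Writing \<open>f\<close> in the basis, the coefficients of \<open>p\<^sub>0, p\<^sub>1, \<dots>\<close> are killed one after the other
  by the zero at \<open>a\<close>, and those of \<open>p\<^sub>n, p\<^sub>n\<^sub>-\<^sub>1, \<dots>\<close> by the zero at \<open>b\<close>.\<close>

lemma bernstein_like_basis_span: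
  assumes B: "bernstein_like_basis Lam a b p" and f: "f \<in> exp_space Lam"
    and "i \<le> n + 1" and "\<And>j. j < i \<Longrightarrow> nderiv j f a = 0"
  shows "\<exists>c. \<forall>j x. nderiv j f x = (\<Sum>k=i..n. c k * nderiv j (p k) x)"
  using assms(3,2,4)
proof (induction i arbitrary: f rule: inc_induct)
  \<comment> \<open>Downward induction starts at \<open>i = n + 1\<close>, where the sum is
    empty.\<close>
  case base
  then have "f = (\<lambda>x. 0)" by (intro exp_space_eq_zero[where a = a]) (auto simp: len)
  then show ?case by simp
next
  case (step i)
  have p: "p i \<in> exp_space Lam" "\<And>j. j < i \<Longrightarrow> nderiv j (p i) a = 0" "nderiv i (p i) a \<noteq> 0"
    using B step.hyps by (auto simp: bernstein_like_basis_def has_zero_of_order_def len)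
  \<comment> \<open>\<open>t\<close> is chosen so that subtracting \<open>t\<close> times
    \<open>p i\<close> raises the order of the zero at \<open>a\<close>.\<close>
  define t where "t = nderiv i f a / nderiv i (p i) a"
  have d: "nderiv j (\<lambda>x. f x - t * p i x) x = nderiv j f x - t * nderiv j (p i) x" for j x
    using step.prems p by (simp add: nderiv_diff exp_space_smooth_fun)
  have "nderiv i f a - t * nderiv i (p i) a = 0" using p(3) by (simp add: t_def)
  then have "\<exists>c. \<forall>j x. nderiv j (\<lambda>x. f x - t * p i x) x = (\<Sum>k=Suc i..n. c k * nderiv j (p k) x)"
    using step.prems p by (intro step.IH exp_space_diff) (auto simp: d less_Suc_eq)
  then obtain c where c: "\<And>j x. nderiv j f x = t * nderiv j (p i) x + (\<Sum>k=Suc i..n. c k * nderiv j (p k) x)"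
    by (auto simp: d diff_eq_eq add.commute)
  have "nderiv j f x = (\<Sum>k=i..n. (c(i := t)) k * nderiv j (p k) x)" for j x
    using step.hyps by (simp add: c sum.atLeast_Suc_atMost)
  then show ?case by blast
qed

lemma bernstein_like_basis_imp_extended_chebyshev:
  assumes B: "bernstein_like_basis Lam a b p"
  shows "extended_chebyshev Lam {a, b}"
  unfolding extended_chebyshev_pair_iff[OF ab]
proof (intro ballI allI impI)
  fix f i m x
  assume f: "f \<in> exp_space Lam" and im: "length Lam - 1 < i + m"
    and za: "\<forall>j<i. nderiv j f a = 0" and zb: "\<forall>j<m. nderiv j f b = 0"
  \<comment> \<open>The minimum covers \<open>i > n + 1\<close>, where the sum is empty.\<close>
  obtain c where c: "\<And>j x. nderiv j f x = (\<Sum>k=min i (n + 1)..n. c k * nderiv j (p k) x)"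
    using bernstein_like_basis_span[OF B f, of "min i (n + 1)"] za by auto
  \<comment> \<open>The derivative of order \<open>j\<close> at \<open>b\<close> isolates index
    \<open>n - j\<close>: smaller indices vanish there to higher order, larger ones already have
    zero coefficients.\<close>
  have "c (n - j) = 0" if "min i (n + 1) \<le> n - j" "j \<le> n" for j
    using that
  proof (induction j rule: less_induct)
    case (less j)
    have "c k * nderiv j (p k) b = 0" if "k \<in> {min i (n + 1)..n} - {n - j}" for k
    proof (cases "k < n - j")
      case True
      then have "nderiv j (p k) b = 0"
        using B that by (auto simp: bernstein_like_basis_def has_zero_of_order_def len)
      then show ?thesis by simp
    next
      case False
      then have "c (n - (n - k)) = 0"
        using that less.prems by (intro less.IH) auto
      then show ?thesis using that by simp
    qed
    then have "(\<Sum>k\<in>{min i (n + 1)..n} - {n - j}. c k * nderiv j (p k) b) = 0"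
      by (rule sum.neutral[OF ballI])
    then have "nderiv j f b = c (n - j) * nderiv j (p (n - j)) b"
      unfolding c using less.prems by (subst sum.remove[of _ "n - j"]) auto
    \<comment> \<open>Here \<open>j \<le> n - i < m\<close>, so this derivative is among the
      prescribed zeros.\<close>
    moreover have "nderiv j f b = 0"
      using zb im less.prems len by auto
    moreover have "nderiv j (p (n - j)) b \<noteq> 0"
      using B less.prems
      by (auto simp: bernstein_like_basis_def has_zero_of_order_def len dest: spec[of _ "n - j"])
    ultimately show ?case by simp
  qed
  then have "c k = 0" if "k \<in> {min i (n + 1)..n}" for k
    using that by (metis atLeastAtMost_iff diff_diff_cancel diff_le_self)
  then show "f x = 0" using c[of 0 x] by simp
qed

end

theorem proposition23:
  fixes Lam :: "complex list" and n :: nat and a b :: real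
  assumes "length Lam = n + 1" and "a \<noteq> b"
  shows "(extended_chebyshev Lam {a, b} \<longleftrightarrow>
            (\<exists>p. bernstein_like_basis Lam a b p \<and> normalized_at n a p)) \<and>
         (\<forall>p p'. bernstein_like_basis Lam a b p \<and> normalized_at n a p \<and>
            bernstein_like_basis Lam a b p' \<and> normalized_at n a p' \<longrightarrow>
            (\<forall>k\<le>n. p k = p' k)) \<and>
         (\<forall>p. bernstein_like_basis Lam a b p \<and> normalized_at n a p \<longrightarrow>
            (let q = (\<lambda>k. p (n - k));
                 \<alpha> = (\<lambda>k. nderiv (k + 1) (q k) b / nderiv k (q k) b);
                 \<beta> = (\<lambda>k. nderiv (k - 1) (q (k - 1)) b / nderiv (k - 2) (q (k - 2)) b)
             in (\<forall>x. q 0 x = fundamental_fun Lam (x - a)) \<and>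
                (1 \<le> n \<longrightarrow> (\<forall>x. q 1 x = nderiv 1 (q 0) x - \<alpha> 0 * q 0 x)) \<and>
                (\<forall>k. 2 \<le> k \<and> k \<le> n \<longrightarrow>
                   (\<forall>x. q k x = nderiv 1 (q (k - 1)) x - (\<alpha> (k - 1) - \<alpha> (k - 2)) * q (k - 1) x
                                 - \<beta> k * q (k - 2) x))))"
proof -
  let ?N = "\<lambda>p. bernstein_like_basis Lam a b p \<and> normalized_at n a p"
  \<comment> \<open>Any normalized basis yields the Chebyshev property, which makes uniqueness and
    the recursion available for it.\<close>
  have C: "extended_chebyshev Lam {a, b}" if "?N p" for p
    using bernstein_like_basis_imp_extended_chebyshev[OF assms] that by blast
  have bern: "bernstein_fun Lam a b (n - k) (p k)" if "?N p" "k \<le> n" for p k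
    using normalized_basis_iff[OF assms C[OF that(1)], of p] that by blast
  have ex: "\<exists>p. ?N p" if ch: "extended_chebyshev Lam {a, b}"
  proof -
    have "\<forall>k. \<exists>f. k \<le> n \<longrightarrow> bernstein_fun Lam a b (n - k) f"
      using bernstein_fun_exists[OF assms ch] by (meson diff_le_self)
    then obtain p where "\<forall>k. k \<le> n \<longrightarrow> bernstein_fun Lam a b (n - k) (p k)"
      by metis
    then show ?thesis
      using normalized_basis_iff[OF assms ch, of p] by blast
  qed
  have uniq: "p k = p' k" if "?N p" "?N p'" "k \<le> n" for p p' k
    using bernstein_fun_unique[OF assms C[OF that(1)] diff_le_self bern[OF that(1,3)] bern[OF that(2,3)]] .
  have rec0: "p n x = fundamental_fun Lam (x - a)" if "?N p" for p x
    using bernstein_fun_0_unique[OF assms _ bernstein_fun_0[OF assms], of "p n"] bern[OF that, of n]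
    by simp
  have rec1: "p (n - 1) x = nderiv 1 (p n) x - nderiv 1 (p n) b / nderiv 0 (p n) b * p n x"
    if "?N p" "1 \<le> n" for p x
  proof -
    have "bernstein_fun Lam a b 0 (p n)" "bernstein_fun Lam a b 1 (p (n - 1))"
      using bern[OF that(1), of n] bern[OF that(1), of "n - 1"] that(2) by auto
    \<comment> \<open>Both sides are normalized functions of index \<open>1\<close>, hence
      equal.\<close>
    from bernstein_fun_unique[OF assms C[OF that(1)] that(2) this(2)
        bernstein_fun_1[OF assms C[OF that(1)] that(2) this(1)]]
    show ?thesis by (rule fun_cong)
  qed
  \<comment> \<open>The index arithmetic is left unsimplified to match the unfolded recursion of the
    statement.\<close>
  have rec2: "p (n - k) x = nderiv 1 (p (n - (k - 1))) x -
      (nderiv (k - 1 + 1) (p (n - (k - 1))) b / nderiv (k - 1) (p (n - (k - 1))) b -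
       nderiv (k - 2 + 1) (p (n - (k - 2))) b / nderiv (k - 2) (p (n - (k - 2))) b) * p (n - (k - 1)) x -
      nderiv (k - 1) (p (n - (k - 1))) b / nderiv (k - 2) (p (n - (k - 2))) b * p (n - (k - 2)) x"
    if N: "?N p" and k: "2 \<le> k" "k \<le> n" for p k x
  proof -
    obtain m where m: "k = Suc (Suc m)" using k by (metis Suc_le_D numeral_2_eq_2 Suc_le_mono)
    have b: "bernstein_fun Lam a b j (p (n - j))" if "j \<le> n" for j
      using bern[OF N, of "n - j"] that by simp
    have "bernstein_fun Lam a b m (p (n - m))" "bernstein_fun Lam a b (Suc m) (p (n - Suc m))"
      using b[of m] b[of "Suc m"] k m by auto
    from bernstein_fun_Suc_Suc[OF assms C[OF N] _ this]
      bernstein_fun_unique[OF assms C[OF N] k(2) b[OF k(2)]]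
    show ?thesis using k m by (auto dest!: fun_cong)
  qed
  show ?thesis
    unfolding Let_def
  proof (intro conjI allI impI, goal_cases)
    case 1
    show ?case using C ex by blast
  next
    case (2 p p' k)
    then show ?case using uniq[of p p' k] by blast
  next
    case (3 p x)
    then show ?case using rec0[of p x] by simp
  next
    case (4 p x)
    then show ?case using rec1[of p x] by simp
  next
    case (5 p k x)
    then show ?case using rec2[of p k x] by blast
  qed
qed

end
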